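(* Let $\mathbb{F}$ be a finite field of characteristic $p$, let $n,m,k,i$ be positive integers, and let $r=ip$. Then $$|\mathcal{P}_{(n,m,k),r}|=|\mathcal{P}_{(n,m,k),i}|.$$
   Context: For positive integers $n,m,k,r$ and a field $\mathbb{F}$, the neuromanifold $\mathcal{P}_{(n,m,k),r}=\mathcal{P}_{(n,m,k),r}(\mathbb{F})$ is the set of all $k$-tuples $(f_1,\dots,f_k)$ of homogeneous polynomials of degree $r$ in $\mathbb{F}[x_1,\dots,x_n]$ of the form $$f_j=\sum_{s=1}^m b_{js}(a_{s1}x_1+\dots+a_{sn}x_n)^r,\qquad j=1,\dots,k,$$ with $(a_{st})\in\mathbb{F}^{m\times n}$ and $(b_{js})\in\mathbb{F}^{k\times m}$ arbitrary. Equality is equality of polynomials, not of functions. *)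

theory Defs
  imports
    "HOL-Library.Poly_Mapping"
    "HOL-Library.FuncSet"
    "HOL-Computational_Algebra.Primes"
begin

text \<open>
  Formal polynomials over \<open>'a\<close> in the variables \<open>x\<^sub>0, x\<^sub>1, \<dots>\<close>: finitely supported maps from monomials
  (finitely supported exponent vectors) to coefficients, with the convolution product of
  \<^theory>\<open>HOL-Library.Poly_Mapping\<close>. The ring \<open>'a[x\<^sub>1, \<dots>, x\<^sub>n]\<close> is the subring of those
  polynomials that only involve \<open>x\<^sub>1, \<dots>, x\<^sub>n\<close>.
\<close>

type_synonym 'a mpoly = "(nat \<Rightarrow>\<^sub>0 nat) \<Rightarrow>\<^sub>0 'a"

definition mconst :: "'a \<Rightarrow> 'a::zero mpoly" where
  "mconst c = Poly_Mapping.single 0 c"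

definition mvar :: "nat \<Rightarrow> 'a::zero_neq_one mpoly" where
  "mvar t = Poly_Mapping.single (Poly_Mapping.single t 1) 1"

definition linear_form :: "nat \<Rightarrow> (nat \<Rightarrow> 'a) \<Rightarrow> 'a::field mpoly" where
  "linear_form n u = (\<Sum>t=1..n. mconst (u t) * mvar t)"

text \<open>
  A matrix is a function of two indices of which only the entries in range are used. A
  \<open>k\<close>-tuple is a function restricted to \<open>{1..k}\<close> (\<open>undefined\<close> elsewhere), so that equality of
  such functions is equality of tuples.
\<close>

definition neuromanifold :: "nat \<Rightarrow> nat \<Rightarrow> nat \<Rightarrow> nat \<Rightarrow> (nat \<Rightarrow> 'a::field mpoly) set" where
  "neuromanifold n m k r =
     {(\<lambda>j\<in>{1..k}. \<Sum>s=1..m. mconst (b j s) * linear_form n (a s) ^ r) |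
        (a :: nat \<Rightarrow> nat \<Rightarrow> 'a) (b :: nat \<Rightarrow> nat \<Rightarrow> 'a). True}"

lemma finite_neuromanifold:
  "finite (neuromanifold n m k r :: (nat \<Rightarrow> 'a::finite_field mpoly) set)"
proof -
  define F where "F = (\<lambda>(a, b). (\<lambda>j\<in>{1..k}. \<Sum>s=1..m. mconst (b (j, s)) *
    linear_form n (\<lambda>t. a (s, t)) ^ r) :: nat \<Rightarrow> 'a mpoly)"
  define A where "A = ({1..m} \<times> {1..n} \<rightarrow>\<^sub>E (UNIV :: 'a set)) \<times> ({1..k} \<times> {1..m} \<rightarrow>\<^sub>E (UNIV :: 'a set))"
  have "neuromanifold n m k r \<subseteq> F ` A"
  proof
    fix f :: "nat \<Rightarrow> 'a mpoly"
    assume "f \<in> neuromanifold n m k r"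
    then obtain a b where f: "f = (\<lambda>j\<in>{1..k}. \<Sum>s=1..m. mconst (b j s) * linear_form n (a s) ^ r)"
      unfolding neuromanifold_def by blast
    define a' where "a' = restrict (case_prod a) ({1..m} \<times> {1..n})"
    define b' where "b' = restrict (case_prod b) ({1..k} \<times> {1..m})"
    have "linear_form n (\<lambda>t. a' (s, t)) = linear_form n (a s)" if "s \<in> {1..m}" for s
      using that by (auto simp: linear_form_def a'_def intro!: sum.cong)
    then have "f = F (a', b')"
      by (auto simp: f F_def b'_def fun_eq_iff restrict_def intro!: sum.cong)
    moreover have "(a', b') \<in> A"
      by (auto simp: A_def a'_def b'_def)
    ultimately show "f \<in> F ` A" by blast
  qed
  moreover have "finite A"
    by (auto simp: A_def intro!: finite_PiE)
  ultimately show ?thesis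
    by (meson finite_imageI finite_subset)
qed

end

theory Submission
  imports Defs
begin

text \<open>
  In characteristic \<open>p\<close> the Frobenius map \<open>f \<mapsto> f ^ p\<close> is an injective ring endomorphism of the
  polynomial ring. Applied to each entry it sends the tuple with parameters \<open>(a, b)\<close> in degree \<open>i\<close>
  to the tuple with parameters \<open>(a, b ^ p)\<close> in degree \<open>i p\<close>. It is onto because every element of a
  finite field is a \<open>p\<close>-th power.
\<close>

text \<open>The image of a natural number in the polynomial ring is a constant polynomial, so it
  vanishes exactly when its coefficient at the monomial 0 does.\<close>

lemma CHAR_mpoly: "CHAR('a::field mpoly) = CHAR('a)"
proof (rule CHAR_eqI)
  show "of_nat CHAR('a) = (0 :: 'a mpoly)"
    by (metis of_nat_CHAR single_of_nat single_zero)
next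
  fix c :: nat
  assume "of_nat c = (0 :: 'a mpoly)"
  then show "CHAR('a) dvd c"
    by (metis lookup_single_eq lookup_zero of_nat_eq_0_iff_char_dvd single_of_nat)
qed

lemma mconst_power: "mconst c ^ q = mconst (c ^ q)"
  for c :: "'a::field"
  by (induction q) (simp_all add: mconst_def mult_single)

text \<open>Additivity of Frobenius turns equal powers into \<open>(x - y) ^ CHAR('a) = 0\<close>,
  and a domain has no nonzero nilpotents. Stated for domains so that it covers both the field and
  its polynomial ring.\<close>

lemma inj_power_CHAR:
  assumes "prime CHAR('a::idom)"
  shows "inj (\<lambda>x :: 'a. x ^ CHAR('a))"
proof (rule injI)
  fix x y :: 'a
  assume eq: "x ^ CHAR('a) = y ^ CHAR('a)"
  have "x ^ CHAR('a) = ((x - y) + y) ^ CHAR('a)" by simp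
  also have "\<dots> = (x - y) ^ CHAR('a) + y ^ CHAR('a)"
    by (rule freshmans_dream[OF assms refl])
  finally show "x = y" using eq by simp
qed

lemma inj_mpoly_power_CHAR: "inj (\<lambda>f :: 'a::finite_field mpoly. f ^ CHAR('a))"
  using inj_power_CHAR[where ?'a = "'a mpoly"] unfolding CHAR_mpoly by simp

text \<open>An injective self-map of a finite set is surjective.\<close>

lemma surj_power_CHAR: "surj (\<lambda>c :: 'a::finite_field. c ^ CHAR('a))"
  by (intro finite_UNIV_inj_surj inj_power_CHAR) simp_all

lemma mpoly_sum_power_CHAR:
  fixes f :: "'b \<Rightarrow> 'a::finite_field mpoly"
  shows "sum f A ^ CHAR('a) = (\<Sum>x\<in>A. f x ^ CHAR('a))"
  by (rule freshmans_dream_sum) (simp_all add: CHAR_mpoly)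

text \<open>Frobenius passes through sums and products. The powers of the linear forms absorb it in
  their exponent, so \<open>a\<close> stays the same and only \<open>b\<close> changes.\<close>

lemma neuron_output_power_CHAR:
  fixes b :: "nat \<Rightarrow> 'a::finite_field"
  shows "(\<Sum>s=1..m. mconst (b s) * linear_form n (a s) ^ i) ^ CHAR('a) =
    (\<Sum>s=1..m. mconst (b s ^ CHAR('a)) * linear_form n (a s) ^ (i * CHAR('a)))"
  by (simp only: mpoly_sum_power_CHAR power_mult_distrib mconst_power power_mult)

lemma neuromanifold_mult_CHAR:
  "neuromanifold n m k (i * CHAR('a)) =
    (\<lambda>f. \<lambda>j\<in>{1..k}. f j ^ CHAR('a)) ` (neuromanifold n m k i :: (nat \<Rightarrow> 'a::finite_field mpoly) set)"
    (is "?L = ?F ` ?R")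
proof
  show "?F ` ?R \<subseteq> ?L"
  proof (rule image_subsetI)
    fix f assume "f \<in> ?R"
    then obtain a b where f: "f = (\<lambda>j\<in>{1..k}. \<Sum>s=1..m. mconst (b j s) * linear_form n (a s) ^ i)"
      unfolding neuromanifold_def by blast
    have "?F f = (\<lambda>j\<in>{1..k}. \<Sum>s=1..m. mconst (b j s ^ CHAR('a)) *
        linear_form n (a s) ^ (i * CHAR('a)))"
      by (rule restrict_ext) (simp add: f neuron_output_power_CHAR del: One_nat_def)
    then show "?F f \<in> ?L"
      unfolding neuromanifold_def
      by (intro CollectI exI[of _ a] exI[of _ "\<lambda>j s. b j s ^ CHAR('a)"] conjI TrueI)
  qed
next
  show "?L \<subseteq> ?F ` ?R"
  proof
    fix g assume "g \<in> ?L"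
    then obtain a b where
      g: "g = (\<lambda>j\<in>{1..k}. \<Sum>s=1..m. mconst (b j s) * linear_form n (a s) ^ (i * CHAR('a)))"
      unfolding neuromanifold_def by blast
    \<comment> \<open>The preimage tuple keeps \<open>a\<close> and replaces each outer coefficient
      by a \<open>CHAR('a)\<close>-th root.\<close>
    define c where "c j s = inv (\<lambda>x :: 'a. x ^ CHAR('a)) (b j s)" for j s
    have c: "c j s ^ CHAR('a) = b j s" for j s
      unfolding c_def by (rule surj_f_inv_f[OF surj_power_CHAR])
    define f where "f = (\<lambda>j\<in>{1..k}. \<Sum>s=1..m. mconst (c j s) * linear_form n (a s) ^ i)"
    have "g = ?F f"
      unfolding g by (rule restrict_ext) (simp add: f_def neuron_output_power_CHAR c del: One_nat_def)
    moreover have "f \<in> ?R" unfolding f_def neuromanifold_def by blast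
    ultimately show "g \<in> ?F ` ?R" by blast
  qed
qed

theorem proposition5p1:
  fixes n m k i p r :: nat
  assumes "p = CHAR('a::finite_field)"
    and "n > 0" and "m > 0" and "k > 0" and "i > 0"
    and "r = i * p"
  shows "card (neuromanifold n m k r :: (nat \<Rightarrow> 'a mpoly) set) =
         card (neuromanifold n m k i :: (nat \<Rightarrow> 'a mpoly) set)"
proof -
  have "inj_on (\<lambda>f. \<lambda>j\<in>{1..k}. f j ^ CHAR('a))
      (neuromanifold n m k i :: (nat \<Rightarrow> 'a mpoly) set)"
  proof (rule inj_onI)
    fix f g :: "nat \<Rightarrow> 'a mpoly"
    assume fg: "f \<in> neuromanifold n m k i" "g \<in> neuromanifold n m k i"
      and eq: "(\<lambda>j\<in>{1..k}. f j ^ CHAR('a)) = (\<lambda>j\<in>{1..k}. g j ^ CHAR('a))"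
    \<comment> \<open>The restricted map forgets values outside \<open>{1..k}\<close>; there both
      tuples are \<open>undefined\<close>, so agreement on the range suffices.\<close>
    from fg have "f \<in> extensional {1..k}" "g \<in> extensional {1..k}"
      by (auto simp: neuromanifold_def)
    then show "f = g"
    proof (rule extensionalityI)
      fix j assume "j \<in> {1..k}"
      with eq have "f j ^ CHAR('a) = g j ^ CHAR('a)" by (auto dest: fun_cong[of _ _ j])
      then show "f j = g j" by (rule injD[OF inj_mpoly_power_CHAR])
    qed
  qed
  then show ?thesis
    unfolding assms(1,6) neuromanifold_mult_CHAR by (rule card_image)
qed

end
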